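(* Consider the robust distributed learning problem and Algorithm A described in the context. Assume: (1) The loss function $f(\theta;z)$ satisfies, for all $\theta,\theta_1,\theta_2$ and $z,z_1,z_2$: $\|\nabla_\theta f(\theta_1;z)-\nabla_\theta f(\theta_2;z)\|\le L_{\theta\theta}\|\theta_1-\theta_2\|$, $\|\nabla_\theta f(\theta;z_1)-\nabla_\theta f(\theta;z_2)\|\le L_{\theta z}\|z_1-z_2\|$, $\|\nabla_z f(\theta_1;z)-\nabla_z f(\theta_2;z)\|\le L_{z\theta}\|\theta_1-\theta_2\|$, $\|\nabla_z f(\theta;z_1)-\nabla_z f(\theta;z_2)\|\le L_{zz}\|z_1-z_2\|$. (2) The function $c(z,x)$ is $L_c$-smooth and $1$-strongly convex with respect to $z$. (3) $\lambda>L_{zz}$. (4) For any specific $\theta_t$, $\max_{1\le k\le N}\big\|\nabla_\theta f(\theta_t;z_k^*(\theta_t))-\frac1N\sum_{j=1}^N\nabla_\theta f(\theta_t;z_j^*(\theta_t))\big\|\le\sigma$. (5) The objective function $F$ is $\lambda_F$-strongly convex. Let $L_F=L_{\theta\theta}+\frac{L_{\theta z}L_{z\theta}}{\lambda-L_{zz}}$ and $C_\alpha=\frac{2\alpha}{1-\beta}$, let $\theta^*$ be the global minimizer of $F$, and suppose $\alpha<\frac{1}{1+2L_F/\lambda_F}<\frac13$. If Algorithm A is run with $\eta=\frac{2}{L_F+\lambda_F}$, then $$\|\theta_T-\theta^*\|\le\left(\frac{2L_FC_\alpha+L_F-\lambda_F}{L_F+\lambda_F}\right)^T\|\theta_0-\theta^*\|+\frac{L_{\theta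 z}\varepsilon+\sigma}{\lambda_F-L_FC_\alpha}.$$
   Context: $\|\cdot\|$ is the Euclidean norm. A differentiable function is $L$-smooth if its gradient is $L$-Lipschitz. Problem. There are $m$ workers and $N=mn$ data points $x_1,\ldots,x_N\in\mathbb{R}^d$; worker $i$ holds $x_{(i-1)n+1},\ldots,x_{(i-1)n+n}$. $f(\theta;z)$ is a real-valued differentiable loss, $\theta\in\mathbb{R}^p$, $z\in\mathbb{R}^d$; $c(z,x)$ is a real-valued transportation cost on $\mathbb{R}^d\times\mathbb{R}^d$; $\lambda\ge0$ is a fixed constant. Put $\phi_\lambda(\theta;x)=\sup_z\{f(\theta;z)-\lambda c(z,x)\}$ and $F(\theta)=\frac1N\sum_{j=1}^N\phi_\lambda(\theta;x_j)$. Let $z_j^*(\theta)=\arg\sup_z\{f(\theta;z)-\lambda c(z,x_j)\}$ denote the exact maximizer. $\nabla_\theta f(\theta_t;z_j^*(\theta_t))$ denotes the gradient of $f$ in its first argument with the second argument held fixed, evaluated at $(\theta_t,z_j^*(\theta_t))$. The workers are partitioned into byzantine workers $\mathcal{B}$, $|\mathcal{B}|=\alpha m$, and honest workers $\mathcal{M}$, $|\mathcal{M}|=(1-\alpha)m$. Norm-based screening. For vectors $g_1,\ldots,g_m$, order indices so that $\|g_{(1)}\|\le\cdots\le\|g_{(m)}\|$, let $\mathcal{U}=\{(1),\ldots,((1-\beta)m)\}$, and set $\mathrm{NormScreen}_\beta(g_1,\ldots,g_m)=\frac1{|\mathcal{U}|}\sum_{i\in\mathcal{U}}g_i$. Algorithm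 A (inputs: screening percentage $\beta\ge\alpha$, step size $\eta$, initial $\theta_0$, number of iterations $T$; the precision is $\varepsilon$). For $t=0,\ldots,T-1$: for every sample $x_j$ of an honest worker, a point $z_j^\varepsilon(\theta_t)$ with $\|z_j^\varepsilon(\theta_t)-z_j^*(\theta_t)\|\le\varepsilon$ is obtained; each honest worker $i\in\mathcal{M}$ sends $g_i(\theta_t)=\frac1n\sum_{j=(i-1)n+1}^{(i-1)n+n}\nabla_\theta f(\theta_t;z_j^\varepsilon(\theta_t))$; each byzantine worker $i\in\mathcal{B}$ sends an arbitrary vector $g_i(\theta_t)\in\mathbb{R}^p$; the server computes $G(\theta_t)=\mathrm{NormScreen}_\beta(g_1(\theta_t),\ldots,g_m(\theta_t))$ and sets $\theta_{t+1}=\theta_t-\eta\,G(\theta_t)$.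
   Formalization: The formal theorem additionally assumes L_F C_α < λ_F (positive denominator of the error term); this follows from the bound on α when β = α, but not for β > α, where the claim fails, e.g. for T = 0, θ_0 = θ* and σ > 0. *)

theory Defs
  imports "HOL-Analysis.Analysis"
begin

text \<open>Meaningful where \<open>f\<close> is differentiable; the gradient is then unique.\<close>

definition gradient :: "('a::euclidean_space \<Rightarrow> real) \<Rightarrow> 'a \<Rightarrow> 'a" where
  "gradient f x = (THE D. GDERIV f x :> D)"

definition smooth_fun :: "real \<Rightarrow> ('a::euclidean_space \<Rightarrow> real) \<Rightarrow> bool" where
  "smooth_fun L f \<longleftrightarrow> f differentiable_on UNIV \<and> L-lipschitz_on UNIV (gradient f)"

definition strongly_convex :: "real \<Rightarrow> ('a::euclidean_space \<Rightarrow> real) \<Rightarrow> bool" where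
  "strongly_convex \<mu> f \<longleftrightarrow> 0 < \<mu> \<and>
     (\<forall>x y. \<forall>t\<in>{0..1}. f ((1 - t) *\<^sub>R x + t *\<^sub>R y)
        \<le> (1 - t) * f x + t * f y - \<mu> / 2 * t * (1 - t) * (norm (x - y))\<^sup>2)"

text \<open>Parameters and transported points live in Euclidean spaces \<open>'a\<close> and \<open>'b\<close>. Under the
  assumptions of the theorem the real-valued supremum below is over a set that is bounded above,
  and the maximizer exists and is unique; otherwise both are unspecified.\<close>

definition robust_loss ::
  "('a \<Rightarrow> 'b \<Rightarrow> real) \<Rightarrow> ('b \<Rightarrow> 'b \<Rightarrow> real) \<Rightarrow> real \<Rightarrow> 'a \<Rightarrow> 'b \<Rightarrow> real" where
  "robust_loss f c lam \<theta> x = (SUP z. f \<theta> z - lam * c z x)"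

definition objective ::
  "('a \<Rightarrow> 'b \<Rightarrow> real) \<Rightarrow> ('b \<Rightarrow> 'b \<Rightarrow> real) \<Rightarrow> real \<Rightarrow> nat \<Rightarrow> (nat \<Rightarrow> 'b) \<Rightarrow> 'a \<Rightarrow> real" where
  "objective f c lam N x \<theta> = (\<Sum>j = 1..N. robust_loss f c lam \<theta> (x j)) / real N"

definition maximizer ::
  "('a \<Rightarrow> 'b \<Rightarrow> real) \<Rightarrow> ('b \<Rightarrow> 'b \<Rightarrow> real) \<Rightarrow> real \<Rightarrow> (nat \<Rightarrow> 'b) \<Rightarrow> nat \<Rightarrow> 'a \<Rightarrow> 'b" where
  "maximizer f c lam x j \<theta> = (ARG_MAX (\<lambda>z. f \<theta> z - lam * c z (x j)) z. True)"

definition samples :: "nat \<Rightarrow> nat \<Rightarrow> nat set" where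
  "samples n i = {(i - 1) * n + 1..(i - 1) * n + n}"

text \<open>A relation because the ordering, hence the output, is not unique when norms are tied;
  \<open>\<pi> k\<close> is the index written \<open>(k)\<close>.\<close>

definition norm_screen :: "real \<Rightarrow> nat \<Rightarrow> (nat \<Rightarrow> 'a::euclidean_space) \<Rightarrow> 'a \<Rightarrow> bool" where
  "norm_screen \<beta> m g G \<longleftrightarrow>
     (\<exists>\<pi>. bij_betw \<pi> {1..m} {1..m} \<and> mono_on {1..m} (\<lambda>k. norm (g (\<pi> k))) \<and>
        (let U = \<pi> ` {k \<in> {1..m}. real k \<le> (1 - \<beta>) * real m}
         in G = (1 / real (card U)) *\<^sub>R (\<Sum>i\<in>U. g i)))"

text \<open>One iteration from \<open>\<theta>\<close> to \<open>\<theta>'\<close>: \<open>z j\<close> are the approximate maximizers and \<open>g i\<close> the messages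
  of the workers; for \<open>i \<in> B\<close> (the byzantine workers) \<open>g i\<close> is unconstrained, so it may depend on
  everything else.\<close>

definition algorithm_step ::
  "('a::euclidean_space \<Rightarrow> 'b::euclidean_space \<Rightarrow> real) \<Rightarrow> ('b \<Rightarrow> 'b \<Rightarrow> real) \<Rightarrow> real \<Rightarrow>
   nat \<Rightarrow> nat \<Rightarrow> (nat \<Rightarrow> 'b) \<Rightarrow> nat set \<Rightarrow> real \<Rightarrow> real \<Rightarrow> real \<Rightarrow> 'a \<Rightarrow> 'a \<Rightarrow> bool" where
  "algorithm_step f c lam m n x B \<beta> \<epsilon> \<eta> \<theta> \<theta>' \<longleftrightarrow>
     (\<exists>z g G.
        (\<forall>i\<in>{1..m} - B. \<forall>j\<in>samples n i. norm (z j - maximizer f c lam x j \<theta>) \<le> \<epsilon>) \<and>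
        (\<forall>i\<in>{1..m} - B.
           g i = (1 / real n) *\<^sub>R (\<Sum>j\<in>samples n i. gradient (\<lambda>\<theta>'. f \<theta>' (z j)) \<theta>)) \<and>
        norm_screen \<beta> m g G \<and>
        \<theta>' = \<theta> - \<eta> *\<^sub>R G)"

end

theory Submission
  imports Defs
begin

text \<open>
  The inner problem \<open>sup\<^sub>z f \<theta> z - \<lambda> c z x\<close> is strongly concave, so its maximizer is Lipschitz in \<open>\<theta>\<close>;
  by Danskin's argument \<open>F\<close> is differentiable with \<open>L\<^sub>F\<close>-Lipschitz gradient, the mean of the gradients
  of \<open>f\<close> at the maximizers. Honest messages are within \<open>\<Delta> = L\<^sub>\<theta>\<^sub>z \<epsilon> + \<sigma>\<close> of \<open>\<nabla>F\<close>, and a byzantine message that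
  survives screening has norm at most \<open>\<parallel>\<nabla>F\<parallel> + \<Delta>\<close>, so \<open>\<parallel>G - \<nabla>F\<parallel> \<le> C\<^sub>\<alpha> \<parallel>\<nabla>F\<parallel> + \<Delta>\<close>. An exact gradient step
  with \<open>\<eta> = 2 / (L\<^sub>F + \<lambda>\<^sub>F)\<close> contracts the distance to the minimizer by \<open>(L\<^sub>F - \<lambda>\<^sub>F) / (L\<^sub>F + \<lambda>\<^sub>F)\<close>; adding the
  error \<open>\<eta> (C\<^sub>\<alpha> L\<^sub>F \<parallel>\<theta> - \<theta>*\<parallel> + \<Delta>)\<close> gives a linear recursion.
\<close>

section \<open>Gradients and derivatives along lines\<close>

lemma gradient_eqI:
  assumes "GDERIV f x :> D"
  shows "gradient f x = D"
  unfolding gradient_def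
proof (rule the_equality)
  fix D' assume "GDERIV f x :> D'"
  then have "(\<lambda>h. h \<bullet> D') = (\<lambda>h. h \<bullet> D)"
    using assms unfolding gderiv_def by (rule has_derivative_unique)
  then show "D' = D"
    by (intro iffD1[OF vector_eq_ldot]) (auto dest: fun_cong)
qed (fact assms)

lemma gderiv_gradient:
  assumes "f differentiable at x"
  shows "GDERIV f x :> gradient f x"
proof -
  obtain f' where f': "(f has_derivative f') (at x)"
    using assms unfolding differentiable_def by blast
  \<comment> \<open>The adjoint of a real functional, evaluated at 1, is the vector representing
    it.\<close>
  have "(\<lambda>h. h \<bullet> adjoint f' 1) = f'"
    using adjoint_works[OF has_derivative_linear[OF f'], of _ 1] by auto
  then have "GDERIV f x :> adjoint f' 1"
    using f' unfolding gderiv_def by simp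
  then show ?thesis
    by (simp add: gradient_eqI)
qed

lemma has_real_derivative_along_line:
  assumes "GDERIV f (x + t *\<^sub>R v) :> D"
  shows "((\<lambda>t. f (x + t *\<^sub>R v)) has_real_derivative v \<bullet> D) (at t within S)"
proof -
  have "((\<lambda>t. x + t *\<^sub>R v) has_derivative (\<lambda>h. h *\<^sub>R v)) (at t within S)"
    by (auto intro!: derivative_eq_intros)
  moreover have "(f has_derivative (\<lambda>h. h \<bullet> D)) (at (x + t *\<^sub>R v))"
    using assms by (simp add: gderiv_def)
  ultimately have "((\<lambda>t. f (x + t *\<^sub>R v)) has_derivative (\<lambda>h. (h *\<^sub>R v) \<bullet> D)) (at t within S)"
    by (rule has_derivative_compose)
  then show ?thesis
    by (simp add: has_field_derivative_def mult_commute_abs)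
qed

section \<open>Quadratic bounds from smoothness and strong convexity\<close>

text \<open>Along the segment, subtract from \<open>f\<close> its linear part at \<open>x\<close>
  and the quadratic allowance. By Cauchy-Schwarz and the Lipschitz bound, the remainder
  \<open>\<phi>\<close> has nonpositive derivative, so
  \<open>\<phi> 1 \<le> \<phi> 0\<close>.\<close>

lemma smooth_upper_bound:
  fixes f :: "'a::euclidean_space \<Rightarrow> real"
  assumes f: "\<And>x. GDERIV f x :> G x"
    and G: "\<And>x y. norm (G x - G y) \<le> L * norm (x - y)"
  shows "f y \<le> f x + (y - x) \<bullet> G x + L / 2 * (norm (y - x))\<^sup>2"
proof -
  define v where "v = y - x"
  define \<phi> where "\<phi> t = f (x + t *\<^sub>R v) - t * (v \<bullet> G x) - L / 2 * t\<^sup>2 * (norm v)\<^sup>2" for t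
  have "\<exists>D. (\<phi> has_real_derivative D) (at t) \<and> D \<le> 0" if "0 \<le> t" for t
  proof (intro exI conjI)
    show "(\<phi> has_real_derivative v \<bullet> G (x + t *\<^sub>R v) - v \<bullet> G x - L * t * (norm v)\<^sup>2) (at t)"
      unfolding \<phi>_def
      by (auto intro!: derivative_eq_intros has_real_derivative_along_line f)
    have "v \<bullet> G (x + t *\<^sub>R v) - v \<bullet> G x = v \<bullet> (G (x + t *\<^sub>R v) - G x)"
      by (simp add: inner_diff_right)
    also have "\<dots> \<le> norm v * norm (G (x + t *\<^sub>R v) - G x)"
      by (rule norm_cauchy_schwarz)
    also have "\<dots> \<le> norm v * (L * norm (t *\<^sub>R v))"
      using G[of "x + t *\<^sub>R v" x] by (intro mult_left_mono) auto
    also have "\<dots> = L * t * (norm v)\<^sup>2"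
      using that by (simp add: power2_eq_square)
    finally show "v \<bullet> G (x + t *\<^sub>R v) - v \<bullet> G x - L * t * (norm v)\<^sup>2 \<le> 0"
      by simp
  qed
  then have "\<phi> 1 \<le> \<phi> 0"
    by (intro DERIV_nonpos_imp_nonincreasing[of 0 1 \<phi>]) simp_all
  then show ?thesis
    by (simp add: \<phi>_def v_def)
qed

lemma smooth_lower_bound:
  fixes f :: "'a::euclidean_space \<Rightarrow> real"
  assumes f: "\<And>x. GDERIV f x :> G x"
    and G: "\<And>x y. norm (G x - G y) \<le> L * norm (x - y)"
  shows "f x + (y - x) \<bullet> G x - L / 2 * (norm (y - x))\<^sup>2 \<le> f y"
proof -
  have "GDERIV (\<lambda>x. - f x) x :> - G x" for x
    using f by (rule GDERIV_minus)
  moreover have "norm (- G x - - G y) \<le> L * norm (x - y)" for x y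
    using G[of x y] by (simp add: norm_minus_commute)
  ultimately have "- f y \<le> - f x + (y - x) \<bullet> (- G x) + L / 2 * (norm (y - x))\<^sup>2"
    by (rule smooth_upper_bound)
  then show ?thesis
    by simp
qed

lemma strongly_convexD:
  assumes "strongly_convex \<mu> f" "0 \<le> t" "t \<le> 1"
  shows "f (x + t *\<^sub>R (y - x)) \<le> f x + t * (f y - f x) - \<mu> / 2 * t * (1 - t) * (norm (y - x))\<^sup>2"
proof -
  have "f ((1 - t) *\<^sub>R x + t *\<^sub>R y)
      \<le> (1 - t) * f x + t * f y - \<mu> / 2 * t * (1 - t) * (norm (x - y))\<^sup>2"
    using assms unfolding strongly_convex_def by auto
  moreover have "(1 - t) *\<^sub>R x + t *\<^sub>R y = x + t *\<^sub>R (y - x)"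
    by (simp add: algebra_simps)
  ultimately show ?thesis
    by (simp add: algebra_simps norm_minus_commute)
qed

text \<open>Dividing by \<open>t\<close> prepares three uses: the limit at a point with a gradient,
  the limit at a minimizer, and a fixed \<open>t\<close> that forces growth at infinity.\<close>

lemma strongly_convex_quotient_bound:
  assumes "strongly_convex \<mu> f" "0 < t" "t < 1"
  shows "(f (x + t *\<^sub>R (y - x)) - f x) / t \<le> f y - f x - \<mu> / 2 * (1 - t) * (norm (y - x))\<^sup>2"
proof -
  have "f (x + t *\<^sub>R (y - x)) - f x \<le> t * (f y - f x - \<mu> / 2 * (1 - t) * (norm (y - x))\<^sup>2)"
    using strongly_convexD[OF assms(1), of t x y] assms by (simp add: algebra_simps)
  then show ?thesis
    using assms by (simp add: pos_divide_le_eq mult.commute)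
qed

lemma strongly_convex_lower_bound:
  assumes "strongly_convex \<mu> f" "GDERIV f x :> D"
  shows "f x + (y - x) \<bullet> D + \<mu> / 2 * (norm (y - x))\<^sup>2 \<le> f y"
proof -
  have "((\<lambda>t. f (x + t *\<^sub>R (y - x))) has_real_derivative (y - x) \<bullet> D) (at 0 within {0<..})"
    using assms(2) by (intro has_real_derivative_along_line) simp
  then have "((\<lambda>t. (f (x + t *\<^sub>R (y - x)) - f x) / t) \<longlongrightarrow> (y - x) \<bullet> D) (at_right 0)"
    by (simp add: has_field_derivative_iff)
  moreover have "((\<lambda>t. f y - f x - \<mu> / 2 * (1 - t) * (norm (y - x))\<^sup>2)
      \<longlongrightarrow> f y - f x - \<mu> / 2 * (1 - 0) * (norm (y - x))\<^sup>2) (at_right 0)"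
    by (intro tendsto_intros)
  moreover have "\<forall>\<^sub>F t in at_right 0.
      (f (x + t *\<^sub>R (y - x)) - f x) / t \<le> f y - f x - \<mu> / 2 * (1 - t) * (norm (y - x))\<^sup>2"
    unfolding eventually_at_right_field
    using strongly_convex_quotient_bound[OF assms(1)] zero_less_one by blast
  ultimately have "(y - x) \<bullet> D \<le> f y - f x - \<mu> / 2 * (1 - 0) * (norm (y - x))\<^sup>2"
    by (intro tendsto_le[of "at_right (0::real)"]) auto
  then show ?thesis
    by simp
qed

text \<open>At a minimizer the difference quotient is nonnegative. With step \<open>1 - s\<close>,
  letting \<open>s\<close> tend to 1 recovers the full constant.\<close>

lemma strongly_convex_min_growth:
  assumes "strongly_convex \<mu> f" "\<And>y. f x \<le> f y"
  shows "f x + \<mu> / 2 * (norm (y - x))\<^sup>2 \<le> f y"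
proof -
  have "s * (\<mu> / 2 * (norm (y - x))\<^sup>2) \<le> f y - f x" if "0 < s" "s < 1" for s
  proof -
    have "0 \<le> (f (x + (1 - s) *\<^sub>R (y - x)) - f x) / (1 - s)"
      using assms(2) that by simp
    also have "\<dots> \<le> f y - f x - \<mu> / 2 * s * (norm (y - x))\<^sup>2"
      using strongly_convex_quotient_bound[OF assms(1), of "1 - s" x y] that by simp
    finally show ?thesis
      by (simp add: mult.commute mult.left_commute)
  qed
  then have "\<mu> / 2 * (norm (y - x))\<^sup>2 \<le> f y - f x"
    by (rule field_le_mult_one_interval)
  then show ?thesis
    by simp
qed

text \<open>Outside a large ball \<open>f\<close> is at least \<open>f 0\<close>, so a minimizer
  over that compact ball is global.\<close>

lemma strongly_convex_attains_min:
  fixes f :: "'a::euclidean_space \<Rightarrow> real"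
  assumes f: "strongly_convex \<mu> f" and cont: "continuous_on UNIV f"
  obtains x where "\<And>y. f x \<le> f y"
proof -
  have \<mu>: "0 < \<mu>"
    using f by (simp add: strongly_convex_def)
  have min: "\<exists>x\<in>cball 0 r. \<forall>y\<in>cball 0 r. f x \<le> f y" if "0 \<le> r" for r
    using that by (intro continuous_attains_inf continuous_on_subset[OF cont]) auto
  obtain w where w: "\<And>y. norm y \<le> 1 \<Longrightarrow> f w \<le> f y"
    using min[of 1] by (meson mem_cball_0 zero_le_one)
  define b where "b = f w"
  have b: "\<And>y. norm y \<le> 1 \<Longrightarrow> b \<le> f y"
    using w by (simp add: b_def)
  \<comment> \<open>\<open>R\<close> is the radius at which
    \<open>b - f 0 + \<mu> / 2 * (R - 1)\<close> vanishes, the sign condition needed below.\<close>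
  define R where "R = 1 + 2 * (f 0 - b) / \<mu>"
  have R: "1 \<le> R"
    using b[of 0] \<mu> by (simp add: R_def)
  obtain x where x: "\<And>y. norm y \<le> R \<Longrightarrow> f x \<le> f y"
    using min[of R] R by (meson mem_cball_0 order_trans zero_le_one)
  have "f x \<le> f y" for y
  proof (cases "norm y \<le> R")
    case False
    \<comment> \<open>This \<open>t\<close> puts \<open>t *\<^sub>R y\<close> on the unit sphere,
      where \<open>b\<close> bounds \<open>f\<close> from below.\<close>
    define t where "t = 1 / norm y"
    have y: "1 < norm y" "R < norm y"
      using False R by auto
    then have "y \<noteq> 0"
      by auto
    have t: "0 < t" "t < 1"
      using y(1) by (auto simp: t_def divide_less_eq)
    have "norm (t *\<^sub>R y) = 1"
      using \<open>y \<noteq> 0\<close> by (simp add: t_def)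
    then have "b \<le> f (0 + t *\<^sub>R (y - 0))"
      using b[of "t *\<^sub>R y"] by simp
    then have "(b - f 0) / t \<le> (f (0 + t *\<^sub>R (y - 0)) - f 0) / t"
      using t by (intro divide_right_mono) auto
    also have "\<dots> \<le> f y - f 0 - \<mu> / 2 * (1 - t) * (norm (y - 0))\<^sup>2"
      by (rule strongly_convex_quotient_bound[OF f t])
    also have "\<dots> = f y - f 0 - \<mu> / 2 * (norm y - 1) * norm y"
      using \<open>y \<noteq> 0\<close> by (simp add: t_def power2_eq_square field_simps)
    finally have "(b - f 0 + \<mu> / 2 * (norm y - 1)) * norm y \<le> f y - f 0"
      by (simp add: t_def algebra_simps)
    moreover have "0 \<le> b - f 0 + \<mu> / 2 * (norm y - 1)"
      using y(2) \<mu> unfolding R_def by (simp add: field_simps)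
    ultimately have "f 0 \<le> f y"
      by (smt (verit) mult_nonneg_nonneg norm_ge_zero)
    then show ?thesis
      using x[of 0] R by simp
  qed (rule x)
  then show thesis
    by (rule that)
qed

section \<open>Contraction of an exact gradient step\<close>

text \<open>At the auxiliary point \<open>y + u\<close>, the strongly convex lower bound based at
  \<open>x\<close> meets the smooth upper bound based at \<open>y\<close>. Optimizing over
  \<open>u\<close> produces the additional squared term.\<close>

lemma strongly_convex_smooth_lower_bound:
  fixes F :: "'a::euclidean_space \<Rightarrow> real"
  assumes F: "\<And>x. GDERIV F x :> G x"
    and G: "\<And>x y. norm (G x - G y) \<le> L * norm (x - y)"
    and sc: "strongly_convex \<mu> F" and "\<mu> < L"
  shows "F x + (y - x) \<bullet> G x + \<mu> / 2 * (norm (y - x))\<^sup>2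
      + (norm (G y - G x - \<mu> *\<^sub>R (y - x)))\<^sup>2 / (2 * (L - \<mu>)) \<le> F y"
proof -
  define e where "e = y - x"
  define d where "d = G y - G x - \<mu> *\<^sub>R e"
  \<comment> \<open>This is the minimizer of
    \<open>u \<bullet> d + (L - \<mu>) / 2 * (norm u)\<^sup>2\<close>.\<close>
  define u where "u = - (1 / (L - \<mu>)) *\<^sub>R d"
  have "F x + (e + u) \<bullet> G x + \<mu> / 2 * (norm (e + u))\<^sup>2 \<le> F (y + u)"
    using strongly_convex_lower_bound[OF sc F, of x "y + u"] by (simp add: e_def algebra_simps)
  also have "\<dots> \<le> F y + u \<bullet> G y + L / 2 * (norm u)\<^sup>2"
    using smooth_upper_bound[OF F G, of "y + u" y] by simp
  finally have "F x + e \<bullet> G x + \<mu> / 2 * (norm e)\<^sup>2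
      - (u \<bullet> (G y - G x - \<mu> *\<^sub>R e) + (L - \<mu>) / 2 * (norm u)\<^sup>2) \<le> F y"
    unfolding power2_norm_eq_inner
    by (simp add: algebra_simps inner_commute add_divide_distrib diff_divide_distrib)
  moreover have "u \<bullet> d + (L - \<mu>) / 2 * (norm u)\<^sup>2 = - (norm d)\<^sup>2 / (2 * (L - \<mu>))"
    using \<open>\<mu> < L\<close> unfolding u_def power2_norm_eq_inner
    by (simp add: divide_simps)
  ultimately show ?thesis
    by (simp add: d_def e_def)
qed

text \<open>Adding the previous bound for \<open>(x, y)\<close> and for \<open>(y, x)\<close>
  cancels the function values. Multiplying by \<open>L - \<mu>\<close> and expanding the square
  gives the claim.\<close>

lemma gradient_coercivity:
  fixes F :: "'a::euclidean_space \<Rightarrow> real"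
  assumes F: "\<And>x. GDERIV F x :> G x"
    and G: "\<And>x y. norm (G x - G y) \<le> L * norm (x - y)"
    and sc: "strongly_convex \<mu> F" and "\<mu> < L"
  shows "L * \<mu> * (norm (x - y))\<^sup>2 + (norm (G x - G y))\<^sup>2 \<le> (L + \<mu>) * ((x - y) \<bullet> (G x - G y))"
proof -
  define e where "e = x - y"
  define D where "D = G x - G y"
  define q where "q = (norm (D - \<mu> *\<^sub>R e))\<^sup>2 / (2 * (L - \<mu>))"
  note lower = strongly_convex_smooth_lower_bound[OF F G sc \<open>\<mu> < L\<close>]
  have "F x - e \<bullet> G x + \<mu> / 2 * (norm e)\<^sup>2 + q \<le> F y"
  proof -
    have "G y - G x - \<mu> *\<^sub>R (y - x) = - (D - \<mu> *\<^sub>R e)"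
      by (simp add: D_def e_def algebra_simps)
    then have "(norm (G y - G x - \<mu> *\<^sub>R (y - x)))\<^sup>2 = (norm (D - \<mu> *\<^sub>R e))\<^sup>2"
      by (simp only: norm_minus_cancel)
    moreover have "(y - x) \<bullet> G x = - (e \<bullet> G x)" "norm (y - x) = norm e"
      by (simp_all add: e_def inner_diff_left norm_minus_commute)
    ultimately show ?thesis
      using lower[of x y] by (simp add: q_def)
  qed
  moreover have "F y + e \<bullet> G y + \<mu> / 2 * (norm e)\<^sup>2 + q \<le> F x"
    using lower[of y x] by (simp add: q_def D_def e_def)
  ultimately have "\<mu> * (norm e)\<^sup>2 + 2 * q \<le> e \<bullet> D"
    by (simp add: D_def inner_diff_right)
  moreover have "0 \<le> L - \<mu>" "2 * q * (L - \<mu>) = (norm (D - \<mu> *\<^sub>R e))\<^sup>2"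
    using \<open>\<mu> < L\<close> unfolding q_def by (simp_all add: divide_eq_eq algebra_simps)
  ultimately have "\<mu> * (norm e)\<^sup>2 * (L - \<mu>) + (norm (D - \<mu> *\<^sub>R e))\<^sup>2 \<le> (e \<bullet> D) * (L - \<mu>)"
    using mult_right_mono[of "\<mu> * (norm e)\<^sup>2 + 2 * q" "e \<bullet> D" "L - \<mu>"]
    by (simp add: distrib_right)
  then show ?thesis
    unfolding power2_norm_eq_inner e_def[symmetric] D_def[symmetric]
    by (simp add: algebra_simps inner_commute)
qed

text \<open>In the expanded square, the step size \<open>2 / (L + \<mu>)\<close> weights the
  gradient terms exactly as coercivity does, so they drop out. The factor left is
  \<open>1 - 4 * L * \<mu> / s\<^sup>2\<close>, the square of
  \<open>(L - \<mu>) / s\<close>.\<close>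

lemma gradient_step_contraction:
  fixes F :: "'a::euclidean_space \<Rightarrow> real"
  assumes F: "\<And>x. GDERIV F x :> G x"
    and G: "\<And>x y. norm (G x - G y) \<le> L * norm (x - y)"
    and sc: "strongly_convex \<mu> F" and "\<mu> < L"
  shows "norm ((x - (2 / (L + \<mu>)) *\<^sub>R G x) - (y - (2 / (L + \<mu>)) *\<^sub>R G y))
    \<le> (L - \<mu>) / (L + \<mu>) * norm (x - y)"
proof (rule power2_le_imp_le)
  define e where "e = x - y"
  define D where "D = G x - G y"
  define s where "s = L + \<mu>"
  have s: "0 < s" "s \<noteq> 0"
    using sc \<open>\<mu> < L\<close> by (auto simp: s_def strongly_convex_def)
  show "0 \<le> (L - \<mu>) / (L + \<mu>) * norm (x - y)"
    using s \<open>\<mu> < L\<close> by (simp add: s_def)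
  have "(x - (2 / s) *\<^sub>R G x) - (y - (2 / s) *\<^sub>R G y) = e - (2 / s) *\<^sub>R D"
    by (simp add: e_def D_def algebra_simps)
  moreover have "(norm (e - k *\<^sub>R D))\<^sup>2 = (norm e)\<^sup>2 - 2 * k * (e \<bullet> D) + k\<^sup>2 * (norm D)\<^sup>2" for k
    unfolding power2_norm_eq_inner
    by (simp add: inner_diff_left inner_diff_right inner_commute power2_eq_square)
  ultimately have "(norm ((x - (2 / s) *\<^sub>R G x) - (y - (2 / s) *\<^sub>R G y)))\<^sup>2
      = (norm e)\<^sup>2 - 4 / s * (e \<bullet> D) + 4 / s\<^sup>2 * (norm D)\<^sup>2"
    by (simp add: power_divide)
  also have "\<dots> = (norm e)\<^sup>2 - 4 / s\<^sup>2 * (s * (e \<bullet> D) - (norm D)\<^sup>2)"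
    using s by (simp add: power2_eq_square field_simps)
  also have "\<dots> \<le> (norm e)\<^sup>2 - 4 / s\<^sup>2 * (L * \<mu> * (norm e)\<^sup>2)"
    using gradient_coercivity[OF F G sc \<open>\<mu> < L\<close>, of x y]
    by (intro diff_left_mono mult_left_mono) (auto simp: e_def D_def s_def)
  also have "\<dots> = ((s\<^sup>2 - 4 * (L * \<mu>)) / s\<^sup>2) * (norm e)\<^sup>2"
    using s by (simp add: field_simps)
  also have "s\<^sup>2 - 4 * (L * \<mu>) = (L - \<mu>)\<^sup>2"
    by (simp add: s_def power2_eq_square algebra_simps)
  also have "(L - \<mu>)\<^sup>2 / s\<^sup>2 * (norm e)\<^sup>2 = ((L - \<mu>) / s * norm e)\<^sup>2"
    by (simp add: power_mult_distrib power_divide)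
  finally show "(norm ((x - (2 / (L + \<mu>)) *\<^sub>R G x) - (y - (2 / (L + \<mu>)) *\<^sub>R G y)))\<^sup>2
      \<le> ((L - \<mu>) / (L + \<mu>) * norm (x - y))\<^sup>2"
    by (simp add: s_def e_def)
qed

section \<open>First-order tools: stationarity, differentiability from error bounds, mean value
  estimates\<close>

lemma gderiv_zero_at_min:
  assumes "GDERIV f x :> D" "\<And>y. f x \<le> f y"
  shows "D = 0"
proof -
  have "(\<lambda>h. h \<bullet> D) = (\<lambda>h. 0)"
    using differential_zero_maxmin[of x UNIV f "\<lambda>h. h \<bullet> D"] assms
    by (simp add: gderiv_def)
  then have "D \<bullet> D = 0"
    by metis
  then show ?thesis
    by simp
qed

text \<open>Serves the envelope argument, which yields two-sided bounds on increments rather than a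
  formula to differentiate.\<close>

lemma gderiv_of_quadratic_error:
  fixes f :: "'a::euclidean_space \<Rightarrow> real"
  assumes "\<And>y. \<bar>f y - f x - (y - x) \<bullet> D\<bar> \<le> K * (norm (y - x))\<^sup>2"
  shows "GDERIV f x :> D"
  unfolding gderiv_def has_derivative_at_within
proof (intro conjI)
  show "bounded_linear (\<lambda>h. h \<bullet> D)"
    by (rule bounded_linear_inner_left)
  have "((\<lambda>y. K * norm (y - x)) \<longlongrightarrow> K * norm (x - x)) (at x)"
    by (intro tendsto_intros)
  then have "((\<lambda>y. K * norm (y - x)) \<longlongrightarrow> 0) (at x)"
    by simp
  moreover have "\<forall>\<^sub>F y in at x.
      norm ((f y - f x - (y - x) \<bullet> D) /\<^sub>R norm (y - x)) \<le> K * norm (y - x)"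
    unfolding eventually_at_filter
  proof (intro always_eventually allI impI)
    fix y assume "y \<noteq> x"
    then show "norm ((f y - f x - (y - x) \<bullet> D) /\<^sub>R norm (y - x)) \<le> K * norm (y - x)"
      using assms[of y] by (simp add: divide_simps power2_eq_square abs_mult mult.assoc)
  qed
  ultimately show "((\<lambda>y. (f y - f x - (y - x) \<bullet> D) /\<^sub>R norm (y - x)) \<longlongrightarrow> 0) (at x)"
    by (rule Lim_null_comparison[rotated])
qed

lemma abs_diff_le_of_gradient_bound:
  fixes f :: "'a::euclidean_space \<Rightarrow> real"
  assumes "\<And>x. GDERIV f x :> G x" "\<And>x. norm (G x) \<le> K"
  shows "\<bar>f x - f y\<bar> \<le> K * norm (x - y)"
proof -
  have "norm (f x - f y) \<le> K * norm (x - y)"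
  proof (rule differentiable_bound[where S = UNIV and f' = "\<lambda>x h. h \<bullet> G x"])
    fix x
    show "(f has_derivative (\<lambda>h. h \<bullet> G x)) (at x within UNIV)"
      using assms(1) by (simp add: gderiv_def)
    show "onorm (\<lambda>h. h \<bullet> G x) \<le> K"
    proof (rule onorm_le)
      fix h
      have "norm (h \<bullet> G x) \<le> norm h * norm (G x)"
        by (simp add: Cauchy_Schwarz_ineq2)
      also have "\<dots> \<le> norm h * K"
        using assms(2) by (intro mult_left_mono) auto
      finally show "norm (h \<bullet> G x) \<le> K * norm h"
        by (simp add: mult.commute)
    qed
  qed auto
  then show ?thesis
    by simp
qed

lemma lipschitz_const_nonneg:
  fixes G :: "'a::euclidean_space \<Rightarrow> 'b::real_normed_vector"
  assumes "\<And>x y. norm (G x - G y) \<le> L * norm (x - y)"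
  shows "0 \<le> L"
proof -
  obtain b :: 'a where "b \<in> Basis"
    using nonempty_Basis by blast
  then show ?thesis
    using assms[of b 0] by (simp add: order_trans[OF norm_ge_zero])
qed

section \<open>Strong concavity of the inner problem\<close>

text \<open>Apply the smooth upper bound at the intermediate point \<open>w\<close> to both
  endpoints. In the weighted sum the terms linear in the gradient at \<open>w\<close>
  cancel.\<close>

lemma smooth_convex_combination:
  fixes f :: "'a::euclidean_space \<Rightarrow> real"
  assumes f: "\<And>x. GDERIV f x :> G x"
    and G: "\<And>x y. norm (G x - G y) \<le> L * norm (x - y)"
    and t: "0 \<le> t" "t \<le> 1"
  shows "(1 - t) * f x + t * f y - L / 2 * t * (1 - t) * (norm (x - y))\<^sup>2
    \<le> f ((1 - t) *\<^sub>R x + t *\<^sub>R y)"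
proof -
  define w where "w = (1 - t) *\<^sub>R x + t *\<^sub>R y"
  define d where "d = x - y"
  have x: "x - w = t *\<^sub>R d" and y: "y - w = (t - 1) *\<^sub>R d"
    by (simp_all add: w_def d_def algebra_simps)
  have "f x \<le> f w + t * (d \<bullet> G w) + L / 2 * t\<^sup>2 * (norm d)\<^sup>2"
    using smooth_upper_bound[OF f G, of x w] unfolding x by (simp add: power_mult_distrib)
  then have "(1 - t) * f x \<le> (1 - t) * (f w + t * (d \<bullet> G w) + L / 2 * t\<^sup>2 * (norm d)\<^sup>2)"
    using t by (intro mult_left_mono) auto
  moreover have "f y \<le> f w - (1 - t) * (d \<bullet> G w) + L / 2 * (1 - t)\<^sup>2 * (norm d)\<^sup>2"
    using smooth_upper_bound[OF f G, of y w] unfolding y norm_scaleR power_mult_distrib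
    by (simp add: power2_commute[of t 1] algebra_simps)
  then have "t * f y \<le> t * (f w - (1 - t) * (d \<bullet> G w) + L / 2 * (1 - t)\<^sup>2 * (norm d)\<^sup>2)"
    using t by (intro mult_left_mono) auto
  ultimately have "(1 - t) * f x + t * f y
      \<le> (1 - t) * (f w + t * (d \<bullet> G w) + L / 2 * t\<^sup>2 * (norm d)\<^sup>2)
        + t * (f w - (1 - t) * (d \<bullet> G w) + L / 2 * (1 - t)\<^sup>2 * (norm d)\<^sup>2)"
    by (rule add_mono)
  also have "\<dots> = f w + L / 2 * t * (1 - t) * (norm d)\<^sup>2"
    by (simp add: field_simps power2_eq_square)
  finally show ?thesis
    by (simp add: w_def d_def)
qed

lemma strongly_convex_penalized:
  fixes f :: "'a::euclidean_space \<Rightarrow> real"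
  assumes f: "\<And>x. GDERIV f x :> G x"
    and G: "\<And>x y. norm (G x - G y) \<le> L * norm (x - y)"
    and c: "strongly_convex 1 c" and "0 \<le> lam" "L < lam"
  shows "strongly_convex (lam - L) (\<lambda>z. lam * c z - f z)"
  unfolding strongly_convex_def
proof (intro conjI allI ballI)
  fix x y :: 'a and t :: real assume "t \<in> {0..1}"
  then have t: "0 \<le> t" "t \<le> 1" by auto
  have "c ((1 - t) *\<^sub>R x + t *\<^sub>R y) \<le> (1 - t) * c x + t * c y - 1 / 2 * t * (1 - t) * (norm (x - y))\<^sup>2"
    using c t by (auto simp: strongly_convex_def)
  then have "lam * c ((1 - t) *\<^sub>R x + t *\<^sub>R y)
      \<le> lam * ((1 - t) * c x + t * c y - 1 / 2 * t * (1 - t) * (norm (x - y))\<^sup>2)"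
    using \<open>0 \<le> lam\<close> by (intro mult_left_mono) auto
  moreover note smooth_convex_combination[OF f G t, of x y]
  moreover have "lam * ((1 - t) * c x + t * c y - 1 / 2 * t * (1 - t) * (norm (x - y))\<^sup>2)
      - ((1 - t) * f x + t * f y - L / 2 * t * (1 - t) * (norm (x - y))\<^sup>2)
    = (1 - t) * (lam * c x - f x) + t * (lam * c y - f y)
      - (lam - L) / 2 * t * (1 - t) * (norm (x - y))\<^sup>2"
    by (simp add: field_simps power2_eq_square)
  ultimately show "lam * c ((1 - t) *\<^sub>R x + t *\<^sub>R y) - f ((1 - t) *\<^sub>R x + t *\<^sub>R y)
      \<le> (1 - t) * (lam * c x - f x) + t * (lam * c y - f y)
        - (lam - L) / 2 * t * (1 - t) * (norm (x - y))\<^sup>2"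
    by linarith
qed (use \<open>L < lam\<close> in simp)

section \<open>Averages and norm-based screening\<close>

text \<open>The bound may vary with the index, so that honest and byzantine messages fit into one
  average.\<close>

lemma norm_mean_diff_le:
  fixes a :: "'i \<Rightarrow> 'a::real_normed_vector"
  assumes "finite A" "A \<noteq> {}" "\<And>j. j \<in> A \<Longrightarrow> norm (a j - v) \<le> K j"
  shows "norm ((1 / real (card A)) *\<^sub>R (\<Sum>j\<in>A. a j) - v) \<le> (\<Sum>j\<in>A. K j) / real (card A)"
proof -
  have card: "0 < real (card A)"
    using assms by (simp add: card_gt_0_iff)
  then have "(1 / real (card A)) *\<^sub>R (\<Sum>j\<in>A. a j) - v = (1 / real (card A)) *\<^sub>R (\<Sum>j\<in>A. a j - v)"
    by (simp add: sum_subtractf scaleR_diff_right sum_constant_scaleR)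
  then have "norm ((1 / real (card A)) *\<^sub>R (\<Sum>j\<in>A. a j) - v) = norm (\<Sum>j\<in>A. a j - v) / real (card A)"
    by simp
  also have "\<dots> \<le> (\<Sum>j\<in>A. K j) / real (card A)"
    using assms card by (intro divide_right_mono sum_norm_le) auto
  finally show ?thesis .
qed

text \<open>Byzantine workers are at most as many as the discarded ones, so a surviving byzantine message
  leaves some honest message discarded, and is no longer than it.\<close>

lemma norm_screen_error:
  fixes g :: "nat \<Rightarrow> 'a::euclidean_space"
  assumes "0 < m" and B: "B \<subseteq> {1..m}" "real (card B) = \<alpha> * real m"
    and \<beta>: "\<alpha> \<le> \<beta>" "\<beta> < 1" "(1 - \<beta>) * real m \<in> \<nat>"
    and screen: "norm_screen \<beta> m g G"
    and honest: "\<And>i. i \<in> {1..m} - B \<Longrightarrow> norm (g i - v) \<le> \<Delta>"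
  shows "norm (G - v) \<le> 2 * \<alpha> / (1 - \<beta>) * norm v + \<Delta>"
proof -
  obtain K where K: "(1 - \<beta>) * real m = real K"
    using \<beta>(3) by (auto elim: Nats_cases)
  have "0 < (1 - \<beta>) * real m"
    using \<beta> \<open>0 < m\<close> by simp
  then have "0 < K"
    using K by simp
  have "real (card B) \<le> \<beta> * real m"
    using B \<beta> by (simp add: mult_right_mono)
  then have "real (card B + K) \<le> real m"
    using K by (simp add: left_diff_distrib)
  then have cardB: "card B + K \<le> m"
    by (simp only: of_nat_le_iff)
  have finB: "finite B"
    using B finite_subset by blast
  obtain \<pi> where \<pi>: "bij_betw \<pi> {1..m} {1..m}"
    and mono: "mono_on {1..m} (\<lambda>k. norm (g (\<pi> k)))"
    and G: "G = (1 / real (card (\<pi> ` {1..K}))) *\<^sub>R (\<Sum>i\<in>\<pi> ` {1..K}. g i)"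
  proof -
    have "{k \<in> {1..m}. real k \<le> (1 - \<beta>) * real m} = {1..K}"
      using cardB by (auto simp: K)
    then show thesis
      using screen that unfolding norm_screen_def Let_def by auto
  qed
  define U where "U = \<pi> ` {1..K}"
  have sub: "{1..K} \<subseteq> {1..m}"
    using cardB by auto
  then have "inj_on \<pi> {1..K}"
    using \<pi> inj_on_subset unfolding bij_betw_def by blast
  then have cardU: "card U = K"
    by (simp add: U_def card_image)
  have "U \<subseteq> {1..m}"
    using \<pi> sub unfolding U_def bij_betw_def by blast
  then have finU: "finite U"
    using finite_subset by blast
  have byz: "norm (g i) \<le> norm v + \<Delta>" if "i \<in> U" "i \<in> B" for i
  proof -
    obtain k where k: "i = \<pi> k" "k \<in> {1..K}"
      using \<open>i \<in> U\<close> by (auto simp: U_def)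
    \<comment> \<open>Pigeonhole: the byzantine \<open>i\<close> leaves only \<open>K - 1\<close>
      places in \<open>U\<close> for at least \<open>K\<close> honest workers.\<close>
    have "card (U - {i}) < K"
      using cardU \<open>0 < K\<close> \<open>i \<in> U\<close> by simp
    also have "K \<le> card ({1..m} - B)"
      using cardB card_Diff_subset[OF finB B(1)] by simp
    finally have "\<not> {1..m} - B \<subseteq> U - {i}"
      using card_mono[of "U - {i}" "{1..m} - B"] finU by fastforce
    then obtain i' where i': "i' \<in> {1..m} - B" "i' \<notin> U"
      using \<open>i \<in> B\<close> by blast
    then have "i' \<in> \<pi> ` {1..m}"
      using \<pi> by (simp add: bij_betw_def)
    then obtain l where l: "i' = \<pi> l" "l \<in> {1..m}"
      by blast
    then have "l \<notin> {1..K}"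
      using i' by (auto simp: U_def)
    then have "norm (g i) \<le> norm (g i')"
      using mono_onD[OF mono, of k l] k l sub by auto
    also have "\<dots> \<le> norm v + norm (g i' - v)"
      using norm_triangle_sub by blast
    finally show ?thesis
      using honest[OF i'(1)] by simp
  qed
  \<comment> \<open>For a byzantine message one \<open>norm v\<close> comes from its length and
    another from the triangle inequality.\<close>
  have "norm (g i - v) \<le> \<Delta> + (if i \<in> B then 2 * norm v else 0)" if "i \<in> U" for i
  proof (cases "i \<in> B")
    case True
    then show ?thesis
      using byz[OF that] norm_triangle_ineq4[of "g i" v] by simp
  next
    case False
    then show ?thesis
      using honest \<open>U \<subseteq> {1..m}\<close> that by auto
  qed
  then have "norm (G - v) \<le> (\<Sum>i\<in>U. \<Delta> + (if i \<in> B then 2 * norm v else 0)) / real (card U)"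
    unfolding G U_def[symmetric] using \<open>0 < K\<close> by (intro norm_mean_diff_le) (auto simp: U_def)
  also have "\<dots> = \<Delta> + real (card (U \<inter> B)) * (2 * norm v) / real K"
    using \<open>0 < K\<close> by (simp add: sum.distrib cardU sum.If_cases finU add_divide_distrib)
  \<comment> \<open>In the worst case every byzantine message survives; the ratio
    \<open>card B / K\<close> is then \<open>\<alpha> / (1 - \<beta>)\<close>.\<close>
  also have "\<dots> \<le> \<Delta> + real (card B) * (2 * norm v) / real K"
    using finB by (intro add_left_mono divide_right_mono mult_right_mono) (auto intro: card_mono)
  also have "real (card B) * (2 * norm v) / real K = 2 * \<alpha> / (1 - \<beta>) * norm v"
    using \<open>0 < m\<close> B by (simp flip: K)
  finally show ?thesis
    by simp
qed

text \<open>\<open>b / (1 - \<rho>)\<close> is the fixed point of the affine recursion, so it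
  reproduces itself in the induction step.\<close>

lemma linear_recursion_bound:
  fixes a :: "nat \<Rightarrow> real"
  assumes step: "\<And>t. t < T \<Longrightarrow> a (Suc t) \<le> \<rho> * a t + b" and \<rho>: "0 \<le> \<rho>" "\<rho> < 1" and "0 \<le> b"
  shows "a T \<le> \<rho> ^ T * a 0 + b / (1 - \<rho>)"
proof -
  have "a t \<le> \<rho> ^ t * a 0 + b / (1 - \<rho>)" if "t \<le> T" for t
    using that
  proof (induction t)
    case 0
    then show ?case
      using \<rho> \<open>0 \<le> b\<close> by simp
  next
    case (Suc t)
    have "a (Suc t) \<le> \<rho> * a t + b"
      using Suc.prems by (intro step) simp
    also have "\<dots> \<le> \<rho> * (\<rho> ^ t * a 0 + b / (1 - \<rho>)) + b"
      using Suc \<rho> by (intro add_right_mono mult_left_mono) auto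
    also have "\<dots> = \<rho> ^ Suc t * a 0 + b / (1 - \<rho>)"
      using \<rho> by (simp add: field_simps)
    finally show ?case .
  qed
  then show ?thesis
    by simp
qed

section \<open>The robust loss, its maximizers and its gradient\<close>

locale robust_learning =
  fixes f :: "'a::euclidean_space \<Rightarrow> 'b::euclidean_space \<Rightarrow> real"
    and c :: "'b \<Rightarrow> 'b \<Rightarrow> real"
    and lam L\<theta>\<theta> L\<theta>z Lz\<theta> Lzz :: real
    and x :: "nat \<Rightarrow> 'b"
  assumes gderiv_\<theta>: "\<And>\<theta> z. GDERIV (\<lambda>\<theta>. f \<theta> z) \<theta> :> gradient (\<lambda>\<theta>. f \<theta> z) \<theta>"
    and gderiv_z: "\<And>\<theta> z. GDERIV (\<lambda>z. f \<theta> z) z :> gradient (\<lambda>z. f \<theta> z) z"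
    and lip_\<theta>\<theta>: "\<And>\<theta>1 \<theta>2 z. norm (gradient (\<lambda>\<theta>. f \<theta> z) \<theta>1 - gradient (\<lambda>\<theta>. f \<theta> z) \<theta>2)
           \<le> L\<theta>\<theta> * norm (\<theta>1 - \<theta>2)"
    and lip_\<theta>z: "\<And>\<theta> z1 z2. norm (gradient (\<lambda>\<theta>. f \<theta> z1) \<theta> - gradient (\<lambda>\<theta>. f \<theta> z2) \<theta>)
           \<le> L\<theta>z * norm (z1 - z2)"
    and lip_z\<theta>: "\<And>\<theta>1 \<theta>2 z. norm (gradient (\<lambda>z. f \<theta>1 z) z - gradient (\<lambda>z. f \<theta>2 z) z)
           \<le> Lz\<theta> * norm (\<theta>1 - \<theta>2)"
    and lip_zz: "\<And>\<theta> z1 z2. norm (gradient (\<lambda>z. f \<theta> z) z1 - gradient (\<lambda>z. f \<theta> z) z2)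
           \<le> Lzz * norm (z1 - z2)"
    and cost_continuous: "\<And>y. continuous_on UNIV (\<lambda>z. c z y)"
    and cost_strongly_convex: "\<And>y. strongly_convex 1 (\<lambda>z. c z y)"
    and lam_nonneg: "0 \<le> lam" and Lzz_less_lam: "Lzz < lam"
begin

abbreviation zmax :: "nat \<Rightarrow> 'a \<Rightarrow> 'b" where
  "zmax j \<theta> \<equiv> maximizer f c lam x j \<theta>"

abbreviation grad :: "'b \<Rightarrow> 'a \<Rightarrow> 'a" where
  "grad z \<theta> \<equiv> gradient (\<lambda>\<theta>. f \<theta> z) \<theta>"

lemma L_nonneg: "0 \<le> L\<theta>\<theta>" "0 \<le> L\<theta>z" "0 \<le> Lz\<theta>"
proof -
  show "0 \<le> L\<theta>\<theta>"
    using lip_\<theta>\<theta> by (rule lipschitz_const_nonneg)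
  show "0 \<le> L\<theta>z"
    using lip_\<theta>z by (rule lipschitz_const_nonneg)
  show "0 \<le> Lz\<theta>"
    using lip_z\<theta>[where z = 0] by (rule lipschitz_const_nonneg)
qed

lemma neg_inner_objective_strongly_convex:
  "strongly_convex (lam - Lzz) (\<lambda>z. lam * c z y - f \<theta> z)"
  using gderiv_z lip_zz cost_strongly_convex lam_nonneg Lzz_less_lam
  by (rule strongly_convex_penalized)

text \<open>\<open>maximizer\<close> is a choice that carries information only once a maximum
  exists. Strong convexity and continuity of the negated inner objective supply one,
  \<open>w\<close>, and the chosen point has the same value.\<close>

lemma zmax_maximal: "f \<theta> z - lam * c z (x j) \<le> f \<theta> (zmax j \<theta>) - lam * c (zmax j \<theta>) (x j)"
proof -
  have "continuous_on UNIV (f \<theta>)"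
    using gderiv_z unfolding gderiv_def
    by (auto intro!: continuous_at_imp_continuous_on has_derivative_continuous)
  then have "continuous_on UNIV (\<lambda>z. lam * c z (x j) - f \<theta> z)"
    by (intro continuous_intros cost_continuous)
  then obtain w where "\<And>z. lam * c w (x j) - f \<theta> w \<le> lam * c z (x j) - f \<theta> z"
    using strongly_convex_attains_min[OF neg_inner_objective_strongly_convex] by blast
  then have "f \<theta> z - lam * c z (x j) \<le> f \<theta> w - lam * c w (x j)" for z
    by (metis minus_diff_eq neg_le_iff_le)
  then have "f \<theta> (zmax j \<theta>) - lam * c (zmax j \<theta>) (x j) = f \<theta> w - lam * c w (x j)"
    unfolding maximizer_def by (intro arg_max_equality) auto
  then show ?thesis
    using \<open>\<And>z. f \<theta> z - lam * c z (x j) \<le> f \<theta> w - lam * c w (x j)\<close> by simp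
qed

lemma robust_loss_eq: "robust_loss f c lam \<theta> (x j) = f \<theta> (zmax j \<theta>) - lam * c (zmax j \<theta>) (x j)"
  unfolding robust_loss_def by (rule cSup_eq_maximum) (auto intro: zmax_maximal)

lemma zmax_growth:
  "f \<theta> z - lam * c z (x j) + (lam - Lzz) / 2 * (norm (z - zmax j \<theta>))\<^sup>2
    \<le> f \<theta> (zmax j \<theta>) - lam * c (zmax j \<theta>) (x j)"
  using strongly_convex_min_growth[OF neg_inner_objective_strongly_convex[of "x j" \<theta>], of "zmax j \<theta>" z]
    zmax_maximal[of \<theta> _ j]
  by (simp add: algebra_simps)

text \<open>Test the growth bound at each maximizer with the other one and add: the costs cancel and
  \<open>(lam - Lzz) * r\<^sup>2\<close> is bounded by a mixed difference of \<open>f\<close>. The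
  mean value inequality for \<open>f \<theta>1 - f \<theta>2\<close> in \<open>z\<close> bounds that
  by \<open>K * r\<close>.\<close>

lemma zmax_lipschitz: "norm (zmax j \<theta>1 - zmax j \<theta>2) \<le> Lz\<theta> / (lam - Lzz) * norm (\<theta>1 - \<theta>2)"
proof -
  define z1 z2 where "z1 = zmax j \<theta>1" and "z2 = zmax j \<theta>2"
  define r where "r = norm (z1 - z2)"
  define K where "K = Lz\<theta> * norm (\<theta>1 - \<theta>2)"
  have "\<bar>(f \<theta>1 z1 - f \<theta>2 z1) - (f \<theta>1 z2 - f \<theta>2 z2)\<bar> \<le> K * r"
    unfolding K_def r_def
    by (rule abs_diff_le_of_gradient_bound) (rule GDERIV_diff gderiv_z lip_z\<theta>)+
  moreover have "f \<theta>1 z2 - lam * c z2 (x j) + (lam - Lzz) / 2 * r\<^sup>2 \<le> f \<theta>1 z1 - lam * c z1 (x j)"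
    using zmax_growth[of \<theta>1 z2 j] by (simp add: z1_def z2_def r_def norm_minus_commute)
  moreover have "f \<theta>2 z1 - lam * c z1 (x j) + (lam - Lzz) / 2 * r\<^sup>2 \<le> f \<theta>2 z2 - lam * c z2 (x j)"
    using zmax_growth[of \<theta>2 z1 j] by (simp add: z1_def z2_def r_def)
  ultimately have "(lam - Lzz) * r\<^sup>2 \<le> K * r"
    by (simp add: field_simps)
  then have "(lam - Lzz) * r \<le> K"
  proof (cases "r = 0")
    case True
    then show ?thesis
      using L_nonneg by (simp add: K_def)
  next
    case False
    then have "0 < r"
      by (simp add: r_def)
    then show ?thesis
      using \<open>(lam - Lzz) * r\<^sup>2 \<le> K * r\<close> by (simp add: power2_eq_square mult.assoc[symmetric])
  qed
  then show ?thesis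
    using Lzz_less_lam unfolding r_def K_def z1_def z2_def
    by (simp add: pos_le_divide_eq mult.commute)
qed

definition LF :: real where
  "LF = L\<theta>\<theta> + L\<theta>z * Lz\<theta> / (lam - Lzz)"

lemma LF_nonneg: "0 \<le> LF"
  using L_nonneg Lzz_less_lam by (simp add: LF_def)

text \<open>\<open>LF - L\<theta>\<theta>\<close> is the share of the smoothness constant caused by
  the motion of the maximizer alone.\<close>

lemma grad_zmax_le:
  "norm (grad (zmax j \<theta>1) \<theta> - grad (zmax j \<theta>2) \<theta>) \<le> (LF - L\<theta>\<theta>) * norm (\<theta>1 - \<theta>2)"
proof -
  have "norm (grad (zmax j \<theta>1) \<theta> - grad (zmax j \<theta>2) \<theta>) \<le> L\<theta>z * norm (zmax j \<theta>1 - zmax j \<theta>2)"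
    by (rule lip_\<theta>z)
  also have "\<dots> \<le> L\<theta>z * (Lz\<theta> / (lam - Lzz) * norm (\<theta>1 - \<theta>2))"
    using L_nonneg by (intro mult_left_mono zmax_lipschitz) auto
  finally show ?thesis
    by (simp add: LF_def)
qed

lemma grad_zmax_lipschitz:
  "norm (grad (zmax j \<theta>1) \<theta>1 - grad (zmax j \<theta>2) \<theta>2) \<le> LF * norm (\<theta>1 - \<theta>2)"
  using norm_diff_triangle_le[OF lip_\<theta>\<theta>[of "zmax j \<theta>1" \<theta>1 \<theta>2] grad_zmax_le[of j \<theta>1 \<theta>2 \<theta>2]]
  by (simp add: algebra_simps)

text \<open>Danskin: playing the maximizer of one point at the other bounds the increment of the
  supremum from both sides by increments of \<open>f\<close> with the second argument frozen.\<close>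

lemma robust_loss_gderiv:
  "GDERIV (\<lambda>\<theta>. robust_loss f c lam \<theta> (x j)) \<theta> :> grad (zmax j \<theta>) \<theta>"
proof (rule gderiv_of_quadratic_error)
  fix \<theta>'
  define z z' where "z = zmax j \<theta>" and "z' = zmax j \<theta>'"
  define d where "d = \<theta>' - \<theta>"
  have lower: "f \<theta>' z - f \<theta> z \<le> robust_loss f c lam \<theta>' (x j) - robust_loss f c lam \<theta> (x j)"
    using zmax_maximal[of \<theta>' z j] by (simp add: robust_loss_eq z_def)
  have "f \<theta> z + d \<bullet> grad z \<theta> - L\<theta>\<theta> / 2 * (norm d)\<^sup>2 \<le> f \<theta>' z"
    unfolding d_def by (rule smooth_lower_bound[OF gderiv_\<theta> lip_\<theta>\<theta>])
  \<comment> \<open>Lets the lower estimate be weakened to the larger constant of the upper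
    one.\<close>
  moreover have "0 \<le> (LF - L\<theta>\<theta>) * (norm d)\<^sup>2"
    using L_nonneg Lzz_less_lam by (simp add: LF_def)
  moreover have upper: "robust_loss f c lam \<theta>' (x j) - robust_loss f c lam \<theta> (x j) \<le> f \<theta>' z' - f \<theta> z'"
    using zmax_maximal[of \<theta> z' j] by (simp add: robust_loss_eq z'_def)
  moreover have "f \<theta>' z' \<le> f \<theta> z' + d \<bullet> grad z' \<theta> + L\<theta>\<theta> / 2 * (norm d)\<^sup>2"
    unfolding d_def by (rule smooth_upper_bound[OF gderiv_\<theta> lip_\<theta>\<theta>])
  moreover have "d \<bullet> grad z' \<theta> - d \<bullet> grad z \<theta> \<le> (LF - L\<theta>\<theta>) * (norm d)\<^sup>2"
  proof -
    have "d \<bullet> grad z' \<theta> - d \<bullet> grad z \<theta> \<le> norm d * norm (grad z' \<theta> - grad z \<theta>)"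
      unfolding inner_diff_right[symmetric] by (rule norm_cauchy_schwarz)
    also have "\<dots> \<le> norm d * ((LF - L\<theta>\<theta>) * norm d)"
      unfolding z_def z'_def d_def by (intro mult_left_mono grad_zmax_le) auto
    finally show ?thesis
      by (simp add: power2_eq_square mult.left_commute)
  qed
  ultimately show "\<bar>robust_loss f c lam \<theta>' (x j) - robust_loss f c lam \<theta> (x j)
      - (\<theta>' - \<theta>) \<bullet> grad (zmax j \<theta>) \<theta>\<bar> \<le> (LF - L\<theta>\<theta> / 2) * (norm (\<theta>' - \<theta>))\<^sup>2"
    using lower unfolding z_def[symmetric] d_def[symmetric]
    by (simp add: abs_le_iff left_diff_distrib)
qed

text \<open>Both the gradient of the objective and the mean from which \<open>\<sigma>\<close>
  measures deviations.\<close>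

definition grad_F :: "nat \<Rightarrow> 'a \<Rightarrow> 'a" where
  "grad_F N \<theta> = (1 / real N) *\<^sub>R (\<Sum>j = 1..N. grad (zmax j \<theta>) \<theta>)"

lemma objective_gderiv:
  assumes "0 < N"
  shows "GDERIV (objective f c lam N x) \<theta> :> grad_F N \<theta>"
proof -
  have "((\<lambda>\<theta>. (\<Sum>j = 1..N. robust_loss f c lam \<theta> (x j)) / real N)
      has_derivative (\<lambda>h. (\<Sum>j = 1..N. h \<bullet> grad (zmax j \<theta>) \<theta>) / real N)) (at \<theta>)"
    using assms robust_loss_gderiv unfolding gderiv_def by (auto intro!: derivative_eq_intros)
  moreover have "(\<lambda>h. (\<Sum>j = 1..N. h \<bullet> grad (zmax j \<theta>) \<theta>) / real N) = (\<lambda>h. h \<bullet> grad_F N \<theta>)"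
    by (auto simp: grad_F_def inner_sum_right)
  ultimately show ?thesis
    unfolding gderiv_def objective_def[abs_def] by simp
qed

lemma grad_F_lipschitz:
  assumes "0 < N"
  shows "norm (grad_F N \<theta>1 - grad_F N \<theta>2) \<le> LF * norm (\<theta>1 - \<theta>2)"
proof -
  have "norm ((1 / real (card {1..N})) *\<^sub>R (\<Sum>j = 1..N. grad (zmax j \<theta>1) \<theta>1 - grad (zmax j \<theta>2) \<theta>2) - 0)
      \<le> (\<Sum>j = 1..N. LF * norm (\<theta>1 - \<theta>2)) / real (card {1..N})"
    using assms by (intro norm_mean_diff_le) (auto simp: grad_zmax_lipschitz)
  then show ?thesis
    using assms by (simp add: grad_F_def sum_subtractf scaleR_diff_right)
qed

end

section \<open>One iteration of the algorithm\<close>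

lemma samples_mean_diff_le:
  fixes a :: "nat \<Rightarrow> 'a::real_normed_vector"
  assumes "0 < n" "\<And>j. j \<in> samples n i \<Longrightarrow> norm (a j - v) \<le> K"
  shows "norm ((1 / real n) *\<^sub>R (\<Sum>j\<in>samples n i. a j) - v) \<le> K"
proof -
  have "card (samples n i) = n"
    by (simp add: samples_def)
  moreover have "finite (samples n i)" "samples n i \<noteq> {}"
    using \<open>0 < n\<close> by (auto simp: samples_def)
  ultimately show ?thesis
    using norm_mean_diff_le[of "samples n i" a v "\<lambda>_. K"] assms by simp
qed

lemma samples_subset: "samples n i \<subseteq> {1..m * n}" if "i \<in> {1..m}"
proof
  fix j assume "j \<in> samples n i"
  moreover have "(i - 1) * n + n = i * n"
    using that by (cases i) auto
  moreover have "i * n \<le> m * n"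
    using that by (intro mult_right_mono) auto
  ultimately show "j \<in> {1..m * n}"
    unfolding samples_def atLeastAtMost_iff by linarith
qed

text \<open>The update is an exact gradient step on the objective, which contracts, plus
  \<open>\<eta>\<close> times the screening error, which is at most linear in the distance to
  \<open>\<theta>star\<close> up to an additive constant.\<close>

lemma (in robust_learning) algorithm_step_contraction:
  assumes "0 < m" "0 < n"
    and B: "B \<subseteq> {1..m}" "real (card B) = \<alpha> * real m"
    and \<beta>: "\<alpha> \<le> \<beta>" "\<beta> < 1" "(1 - \<beta>) * real m \<in> \<nat>"
    and \<sigma>: "\<And>j. j \<in> {1..m * n} \<Longrightarrow> norm (grad (zmax j \<theta>) \<theta> - grad_F (m * n) \<theta>) \<le> \<sigma>"
    and sc: "strongly_convex \<mu> (objective f c lam (m * n) x)" and "\<mu> < LF"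
    and min: "\<And>\<theta>. objective f c lam (m * n) x \<theta>star \<le> objective f c lam (m * n) x \<theta>"
    and step: "algorithm_step f c lam m n x B \<beta> \<epsilon> (2 / (LF + \<mu>)) \<theta> \<theta>'"
  shows "norm (\<theta>' - \<theta>star)
    \<le> (2 * LF * (2 * \<alpha> / (1 - \<beta>)) + LF - \<mu>) / (LF + \<mu>) * norm (\<theta> - \<theta>star)
      + 2 * (L\<theta>z * \<epsilon> + \<sigma>) / (LF + \<mu>)"
proof -
  define N where "N = m * n"
  define \<eta> where "\<eta> = 2 / (LF + \<mu>)"
  define C where "C = 2 * \<alpha> / (1 - \<beta>)"
  define \<Delta> where "\<Delta> = L\<theta>z * \<epsilon> + \<sigma>"
  have "0 < N"
    using assms by (simp add: N_def)
  have "0 < LF + \<mu>"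
    using sc \<open>\<mu> < LF\<close> by (auto simp: strongly_convex_def)
  then have "0 \<le> \<eta>"
    by (simp add: \<eta>_def)
  have "0 \<le> \<alpha>"
    using B(2) \<open>0 < m\<close> by (metis of_nat_0_le_iff of_nat_0_less_iff zero_le_mult_iff not_le)
  then have "0 \<le> C"
    using \<beta> by (simp add: C_def)
  obtain z g G where z: "\<And>i j. i \<in> {1..m} - B \<Longrightarrow> j \<in> samples n i \<Longrightarrow> norm (z j - zmax j \<theta>) \<le> \<epsilon>"
    and g: "\<And>i. i \<in> {1..m} - B \<Longrightarrow> g i = (1 / real n) *\<^sub>R (\<Sum>j\<in>samples n i. grad (z j) \<theta>)"
    and screen: "norm_screen \<beta> m g G" and \<theta>': "\<theta>' = \<theta> - \<eta> *\<^sub>R G"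
    using step unfolding algorithm_step_def \<eta>_def by blast
  have honest: "norm (g i - grad_F N \<theta>) \<le> \<Delta>" if i: "i \<in> {1..m} - B" for i
    unfolding g[OF i]
  proof (rule samples_mean_diff_le[OF \<open>0 < n\<close>])
    fix j assume j: "j \<in> samples n i"
    have "norm (grad (z j) \<theta> - grad (zmax j \<theta>) \<theta>) \<le> L\<theta>z * norm (z j - zmax j \<theta>)"
      by (rule lip_\<theta>z)
    also have "\<dots> \<le> L\<theta>z * \<epsilon>"
      using z[OF i j] L_nonneg by (intro mult_left_mono) auto
    finally show "norm (grad (z j) \<theta> - grad_F N \<theta>) \<le> \<Delta>"
      unfolding \<Delta>_def N_def
    proof (rule norm_diff_triangle_le)
      show "norm (grad (zmax j \<theta>) \<theta> - grad_F (m * n) \<theta>) \<le> \<sigma>"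
        using i j samples_subset[of i m n] by (intro \<sigma>) auto
    qed
  qed
  \<comment> \<open>Stationarity is used twice: it turns the Lipschitz bound into a bound on the
    gradient itself, and it makes \<open>\<theta>star\<close> a fixed point of the exact
    step.\<close>
  have star: "grad_F N \<theta>star = 0"
    using gderiv_zero_at_min[OF objective_gderiv[OF \<open>0 < N\<close>]] min unfolding N_def by blast
  have "norm (grad_F N \<theta>) \<le> LF * norm (\<theta> - \<theta>star)"
    using grad_F_lipschitz[OF \<open>0 < N\<close>, of \<theta> \<theta>star] by (simp add: star)
  then have "norm (G - grad_F N \<theta>) \<le> C * (LF * norm (\<theta> - \<theta>star)) + \<Delta>"
    using norm_screen_error[OF \<open>0 < m\<close> B \<beta> screen honest] \<open>0 \<le> C\<close>
    unfolding C_def[symmetric] by (smt (verit) mult_left_mono)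
  then have "\<eta> * norm (G - grad_F N \<theta>) \<le> \<eta> * (C * (LF * norm (\<theta> - \<theta>star)) + \<Delta>)"
    using \<open>0 \<le> \<eta>\<close> by (rule mult_left_mono)
  moreover have "norm ((\<theta> - \<eta> *\<^sub>R grad_F N \<theta>) - \<theta>star) \<le> (LF - \<mu>) / (LF + \<mu>) * norm (\<theta> - \<theta>star)"
    using gradient_step_contraction[OF objective_gderiv[OF \<open>0 < N\<close>] grad_F_lipschitz[OF \<open>0 < N\<close>]
        sc[folded N_def] \<open>\<mu> < LF\<close>, of \<theta> \<theta>star]
    by (simp add: star \<eta>_def)
  moreover have "\<theta>' - \<theta>star = ((\<theta> - \<eta> *\<^sub>R grad_F N \<theta>) - \<theta>star) - \<eta> *\<^sub>R (G - grad_F N \<theta>)"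
    by (simp add: \<theta>' algebra_simps)
  then have "norm (\<theta>' - \<theta>star)
      \<le> norm ((\<theta> - \<eta> *\<^sub>R grad_F N \<theta>) - \<theta>star) + \<eta> * norm (G - grad_F N \<theta>)"
    using norm_triangle_ineq4[of "(\<theta> - \<eta> *\<^sub>R grad_F N \<theta>) - \<theta>star" "\<eta> *\<^sub>R (G - grad_F N \<theta>)"] \<open>0 \<le> \<eta>\<close>
    by (simp only: norm_scaleR abs_of_nonneg)
  ultimately have "norm (\<theta>' - \<theta>star)
      \<le> (LF - \<mu>) / (LF + \<mu>) * norm (\<theta> - \<theta>star) + \<eta> * (C * (LF * norm (\<theta> - \<theta>star)) + \<Delta>)"
    by linarith
  also have "\<dots> = (2 * LF * C + LF - \<mu>) / (LF + \<mu>) * norm (\<theta> - \<theta>star) + 2 * \<Delta> / (LF + \<mu>)"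
    using \<open>0 < LF + \<mu>\<close> by (simp add: \<eta>_def divide_simps) (simp add: algebra_simps)
  finally show ?thesis
    by (simp add: C_def \<Delta>_def)
qed

section \<open>Convergence over all iterations\<close>

lemma differentiable_partial:
  assumes "(\<lambda>(x, y). f x y) differentiable_on UNIV"
  shows "(\<lambda>x. f x y) differentiable at x" "(\<lambda>y. f x y) differentiable at y"
proof -
  have f: "(\<lambda>(x, y). f x y) differentiable at (x, y)"
    using assms by (simp add: differentiable_on_def)
  have "(\<lambda>x. (x, y)) differentiable at x"
    unfolding differentiable_def by (auto intro!: derivative_eq_intros)
  from differentiable_chain_at[OF this f] show "(\<lambda>x. f x y) differentiable at x"
    by (simp add: o_def)
  have "(\<lambda>y. (x, y)) differentiable at y"
    unfolding differentiable_def by (auto intro!: derivative_eq_intros)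
  from differentiable_chain_at[OF this f] show "(\<lambda>y. f x y) differentiable at y"
    by (simp add: o_def)
qed

theorem theorem4:
  fixes f :: "real ^ 'p \<Rightarrow> real ^ 'd \<Rightarrow> real"
    and c :: "real ^ 'd \<Rightarrow> real ^ 'd \<Rightarrow> real"
    and x :: "nat \<Rightarrow> real ^ 'd"
    and \<theta> :: "nat \<Rightarrow> real ^ 'p"
    and \<theta>star :: "real ^ 'p"
    and m n N T :: nat
    and B :: "nat set"
    and lam \<alpha> \<beta> \<epsilon> \<eta> \<sigma> L\<theta>\<theta> L\<theta>z Lz\<theta> Lzz Lc LF lamF C\<alpha> :: real
  assumes "0 < m" and "0 < n" and "N = m * n"
    and "0 \<le> lam"
    and "B \<subseteq> {1..m}" and "real (card B) = \<alpha> * real m"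
    and "\<alpha> \<le> \<beta>" and "\<beta> < 1" and "(1 - \<beta>) * real m \<in> \<nat>"
    and "0 \<le> \<epsilon>" and "0 \<le> \<sigma>"
    and "(\<lambda>(\<theta>, z). f \<theta> z) differentiable_on UNIV"
    and "\<forall>\<theta>1 \<theta>2 z. norm (gradient (\<lambda>\<theta>. f \<theta> z) \<theta>1 - gradient (\<lambda>\<theta>. f \<theta> z) \<theta>2)
           \<le> L\<theta>\<theta> * norm (\<theta>1 - \<theta>2)"
    and "\<forall>\<theta> z1 z2. norm (gradient (\<lambda>\<theta>. f \<theta> z1) \<theta> - gradient (\<lambda>\<theta>. f \<theta> z2) \<theta>)
           \<le> L\<theta>z * norm (z1 - z2)"
    and "\<forall>\<theta>1 \<theta>2 z. norm (gradient (\<lambda>z. f \<theta>1 z) z - gradient (\<lambda>z. f \<theta>2 z) z)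
           \<le> Lz\<theta> * norm (\<theta>1 - \<theta>2)"
    and "\<forall>\<theta> z1 z2. norm (gradient (\<lambda>z. f \<theta> z) z1 - gradient (\<lambda>z. f \<theta> z) z2)
           \<le> Lzz * norm (z1 - z2)"
    and "\<forall>y. smooth_fun Lc (\<lambda>z. c z y)" and "\<forall>y. strongly_convex 1 (\<lambda>z. c z y)"
    and "lam > Lzz"
    and "\<forall>t<T. (MAX k\<in>{1..N}.
           norm (gradient (\<lambda>\<theta>'. f \<theta>' (maximizer f c lam x k (\<theta> t))) (\<theta> t)
             - (1 / real N) *\<^sub>R
                 (\<Sum>j = 1..N. gradient (\<lambda>\<theta>'. f \<theta>' (maximizer f c lam x j (\<theta> t))) (\<theta> t)))) \<le> \<sigma>"
    and "strongly_convex lamF (objective f c lam N x)"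
    and "LF = L\<theta>\<theta> + L\<theta>z * Lz\<theta> / (lam - Lzz)"
    and "C\<alpha> = 2 * \<alpha> / (1 - \<beta>)"
    and "is_arg_min (objective f c lam N x) (\<lambda>_. True) \<theta>star"
    and "\<alpha> < 1 / (1 + 2 * LF / lamF)" and "1 / (1 + 2 * LF / lamF) < 1 / 3"
    \<comment> \<open>positive denominator in the conclusion; follows from the bound on \<open>\<alpha>\<close> if \<open>\<beta> = \<alpha>\<close>\<close>
    and "LF * C\<alpha> < lamF"
    and "\<eta> = 2 / (LF + lamF)"
    and "\<forall>t<T. algorithm_step f c lam m n x B \<beta> \<epsilon> \<eta> (\<theta> t) (\<theta> (Suc t))"
  shows "norm (\<theta> T - \<theta>star)
    \<le> ((2 * LF * C\<alpha> + LF - lamF) / (LF + lamF)) ^ T * norm (\<theta> 0 - \<theta>star)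
       + (L\<theta>z * \<epsilon> + \<sigma>) / (lamF - LF * C\<alpha>)"
proof -
  interpret robust_learning f c lam L\<theta>\<theta> L\<theta>z Lz\<theta> Lzz x
  proof unfold_locales
    fix \<theta> z
    show "GDERIV (\<lambda>\<theta>. f \<theta> z) \<theta> :> gradient (\<lambda>\<theta>. f \<theta> z) \<theta>"
      "GDERIV (\<lambda>z. f \<theta> z) z :> gradient (\<lambda>z. f \<theta> z) z"
      using differentiable_partial[OF assms(12)] by (auto intro: gderiv_gradient)
  next
    fix y
    show "continuous_on UNIV (\<lambda>z. c z y)"
      using assms(17) unfolding smooth_fun_def by (auto intro: differentiable_imp_continuous_on)
  qed (use assms in auto)
  \<comment> \<open>Identifies the locale constant with the variable \<open>LF\<close> of the
    theorem, which hides its short name.\<close>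
  have LF: "robust_learning.LF lam L\<theta>\<theta> L\<theta>z Lz\<theta> Lzz = LF"
    unfolding LF_def \<open>LF = _\<close> ..
  have N: "0 < N" and card: "N = m * n"
    using assms by auto
  have lamF: "0 < lamF"
    using assms(21) by (simp add: strongly_convex_def)
  have "0 \<le> LF"
    using LF_nonneg LF by simp
  \<comment> \<open>The bound by \<open>1 / 3\<close> means \<open>1 + 2 * LF / lamF > 3\<close>;
    the strict gap is what the coercivity estimate requires.\<close>
  then have "lamF < LF"
    using \<open>1 / (1 + 2 * LF / lamF) < 1 / 3\<close> lamF by (simp add: field_simps)
  have "0 \<le> \<alpha>"
    using assms(1,6) by (metis of_nat_0_le_iff of_nat_0_less_iff zero_le_mult_iff not_le)
  then have "0 \<le> C\<alpha>"
    using assms by simp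
  define \<rho> where "\<rho> = (2 * LF * C\<alpha> + LF - lamF) / (LF + lamF)"
  define b where "b = 2 * (L\<theta>z * \<epsilon> + \<sigma>) / (LF + lamF)"
  have \<rho>: "0 \<le> \<rho>"
    using mult_nonneg_nonneg[OF \<open>0 \<le> LF\<close> \<open>0 \<le> C\<alpha>\<close>] \<open>lamF < LF\<close> lamF by (simp add: \<rho>_def)
  \<comment> \<open>Shows that \<open>\<rho> < 1\<close> amounts to
    \<open>LF * C\<alpha> < lamF\<close>, and that the factor \<open>2 / (LF + lamF)\<close> cancels
    in \<open>b / (1 - \<rho>)\<close>.\<close>
  have \<rho>1: "1 - \<rho> = 2 * (lamF - LF * C\<alpha>) / (LF + lamF)"
    using \<open>lamF < LF\<close> lamF by (simp add: \<rho>_def field_simps)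
  then have "\<rho> < 1"
    using \<open>lamF < LF\<close> lamF \<open>LF * C\<alpha> < lamF\<close> by (smt (verit) divide_pos_pos)
  have "0 \<le> b"
    using \<open>lamF < LF\<close> lamF L_nonneg assms(10,11) by (simp add: b_def)
  have "norm (\<theta> (Suc t) - \<theta>star) \<le> \<rho> * norm (\<theta> t - \<theta>star) + b" if "t < T" for t
  proof -
    have "norm (grad (zmax j (\<theta> t)) (\<theta> t) - grad_F (m * n) (\<theta> t)) \<le> \<sigma>" if j: "j \<in> {1..m * n}" for j
    proof -
      have "norm (grad (zmax j (\<theta> t)) (\<theta> t) - grad_F N (\<theta> t))
          \<le> (MAX k\<in>{1..N}. norm (grad (zmax k (\<theta> t)) (\<theta> t) - grad_F N (\<theta> t)))"
        using j card by (intro Max_ge) auto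
      also have "\<dots> \<le> \<sigma>"
        using assms(20) \<open>t < T\<close> unfolding grad_F_def by blast
      finally show ?thesis
        by (simp add: card)
    qed
    moreover have "objective f c lam N x \<theta>star \<le> objective f c lam N x \<theta>'" for \<theta>'
      using assms(24) by (simp add: is_arg_min_linorder)
    ultimately show ?thesis
      using algorithm_step_contraction[of m n B \<alpha> \<beta> "\<theta> t" \<sigma> lamF \<theta>star \<epsilon> "\<theta> (Suc t)"]
        assms \<open>lamF < LF\<close> \<open>t < T\<close>
      unfolding LF by (simp add: \<rho>_def b_def)
  qed
  then have "norm (\<theta> T - \<theta>star) \<le> \<rho> ^ T * norm (\<theta> 0 - \<theta>star) + b / (1 - \<rho>)"
    using \<rho> \<open>\<rho> < 1\<close> \<open>0 \<le> b\<close> by (rule linear_recursion_bound)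
  also have "b / (1 - \<rho>) = (L\<theta>z * \<epsilon> + \<sigma>) / (lamF - LF * C\<alpha>)"
  proof -
    have cancel: "(2 * p / s) / (2 * q / s) = p / q" if "s \<noteq> 0" for p q s :: real
      using that by simp
    show ?thesis
      unfolding b_def \<rho>1 by (rule cancel) (use \<open>lamF < LF\<close> lamF in simp)
  qed
  finally show ?thesis
    by (simp add: \<rho>_def)
qed

end
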